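(* Let $R\subseteq\mathbb{T}$ be a set of tapes and let $x$ and $y$ be representations of a countable set $A$ with $\mathrm{comp}^R(x)\subseteq\mathrm{comp}^R(y)$. If $x(A)$ is $R$-c.e., then: (i) $y(A)$ is $R$-c.e.; (ii) $x$ and $y$ are $R$-transformationally equivalent; (iii) $\mathrm{comp}^R(x)=\mathrm{comp}^R(y)$.
   Context: $\mathbb{T}$ denotes the set of tapes over a fixed finite alphabet with finitely many non-blank symbols. A Turing machine with oracle $R\subseteq\mathbb{T}$ is a Turing machine with an extra operation which, given a tape $\tau$, tells whether $\tau\in R$. For $Q\subseteq\mathbb{T}$, a function with domain $Q$ is $R$-computable if some Turing machine with oracle $R$, on every input $\tau\in Q$, halts with output equal to the function's value (nothing required outside $Q$). A set $Q\subseteq\mathbb{T}$ is $R$-c.e. if there are an $R$-computable $h$ with domain $Q$ and values in $Q$ and $\tau_0\in Q$ such that every element of $Q$ is $h^i(\tau_0)$ for some $i$. A representation of $A$ is an injective function $A\to\mathbb{T}$. $\mathrm{comp}^R(x)$ is the set of functions $g$ with domain $A$ and values in $A$ such that $x\circ g\circ x^{-1}$ is $R$-computable on $x(A)$. Representations $x,y$ are $R$-transformationally equivalent if $y\circ x^{-1}$ (on $x(A)$) and $x\circ y^{-1}$ (on $y(A)$) are both $R$-computable. Standing assumptions: a fixed tape pairing bijection with computable duplication, swap, projections and partial application, and a Turing machine deciding equality of the two components of a pair. *)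

theory Defs
  imports Main "HOL-Library.FuncSet" "HOL-Library.Countable_Set" "HOL-Library.Finite_Map"
begin

section \<open>Tapes\<close>

text \<open>The alphabet consists of the blank symbol \<open>None\<close> and the non-blank symbols \<open>Some s\<close>,
  where \<open>s\<close> ranges over a finite type. A tape with finitely many non-blank symbols is
  therefore a finite partial map on the integers. The cell with index 0 is the one under the
  head: indices are relative to the head, so moving the head shifts the indices.\<close>

type_synonym 's tape = "(int, 's) fmap"

section \<open>Turing machines with an oracle\<close>

text \<open>While a machine is running, a cell holds either a symbol of the alphabet or the marker
  \<open>Outside\<close>. A halting run scans only finitely many cells, so on undelimited two-way
  infinite tapes a machine could never recognise that it has seen all non-blank symbols, and
  could not even decide equality of tapes. Hence a tape is loaded with \<open>Outside\<close>
  everywhere beyond the smallest interval that contains the head and all non-blank symbols.\<close>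

datatype 's cell = Outside | Cell "'s option"

definition load :: "'s tape \<Rightarrow> int \<Rightarrow> 's cell" where
  "load \<tau> i =
     (let S = insert 0 (fset (fmdom \<tau>))
      in if i \<in> {Min S..Max S} then Cell (fmlookup \<tau> i) else Outside)"

text \<open>The tape that is read off from given cells; \<open>Outside\<close> counts as blank.\<close>

definition holds_tape :: "(int \<Rightarrow> 's cell) \<Rightarrow> 's tape \<Rightarrow> bool" where
  "holds_tape c \<tau> \<longleftrightarrow>
     (\<forall>i. fmlookup \<tau> i = (case c i of Outside \<Rightarrow> None | Cell s \<Rightarrow> s))"

datatype move = Left | Stay | Right

fun offset :: "move \<Rightarrow> int" where
  "offset Left = -1"
| "offset Stay = 0"
| "offset Right = 1"

text \<open>A machine is a finite list of actions; its control states are the positions of the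
  list, it starts in state 0 and halts on leaving the list. The tapes are numbered, and a
  machine uses only the finitely many tapes named in its actions. In a state with action
  \<open>Act k \<delta>\<close>, if \<open>a\<close> is scanned on tape \<open>k\<close> and
  \<open>\<delta> a = (q, b, d)\<close>, then \<open>b\<close> is written, the head of tape \<open>k\<close>
  moves by \<open>d\<close>, and the next state is \<open>q\<close>. In a state with action
  \<open>Query k p q\<close> the oracle tells whether the tape held on tape \<open>k\<close> belongs to it;
  the next state is \<open>p\<close> if it does and \<open>q\<close> otherwise. There are several tapes so
  that the oracle can be asked about a tape without giving up the rest of the computation.\<close>

datatype 's action =
    Act nat "'s cell \<Rightarrow> nat \<times> 's cell \<times> move"
  | Query nat nat nat

type_synonym 's machine = "'s action list"

type_synonym 's config = "nat \<times> (nat \<Rightarrow> int \<Rightarrow> 's cell)"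

fun exec :: "'s tape set \<Rightarrow> 's action \<Rightarrow> (nat \<Rightarrow> int \<Rightarrow> 's cell) \<Rightarrow> 's config" where
  "exec R (Act k \<delta>) c =
     (case \<delta> (c k 0) of (q, b, d) \<Rightarrow>
        (q, c(k := (\<lambda>i. ((c k)(0 := b)) (i + offset d)))))"
| "exec R (Query k p q) c = (if \<exists>\<tau>\<in>R. holds_tape (c k) \<tau> then p else q, c)"

fun step :: "'s tape set \<Rightarrow> 's machine \<Rightarrow> 's config \<Rightarrow> 's config" where
  "step R M (q, c) = (if q < length M then exec R (M ! q) c else (q, c))"

text \<open>Tape 0 carries the input and the output; all other tapes are blank.\<close>

definition io_tapes :: "'s tape \<Rightarrow> nat \<Rightarrow> int \<Rightarrow> 's cell" where
  "io_tapes \<tau> k = load (if k = 0 then \<tau> else fmempty)"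

text \<open>A machine has to erase its auxiliary tapes and delimit its output before it halts.
  This costs no generality: a machine can record on further tapes which cells it has visited,
  and clean up in the end.\<close>

definition halts_with ::
  "'s tape set \<Rightarrow> 's machine \<Rightarrow> 's tape \<Rightarrow> 's tape \<Rightarrow> bool" where
  "halts_with R M \<tau> \<sigma> \<longleftrightarrow>
     (\<exists>n q. (step R M ^^ n) (0, io_tapes \<tau>) = (q, io_tapes \<sigma>) \<and> length M \<le> q)"

definition computable_on ::
  "'s tape set \<Rightarrow> 's tape set \<Rightarrow> ('s tape \<Rightarrow> 's tape) \<Rightarrow> bool" where
  "computable_on R Q f \<longleftrightarrow> (\<exists>M. \<forall>\<tau>\<in>Q. halts_with R M \<tau> (f \<tau>))"

definition ce :: "'s tape set \<Rightarrow> 's tape set \<Rightarrow> bool" where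
  "ce R Q \<longleftrightarrow>
     (\<exists>h \<tau>\<^sub>0. h \<in> Q \<rightarrow> Q \<and> computable_on R Q h \<and> \<tau>\<^sub>0 \<in> Q \<and>
        (\<forall>\<tau>\<in>Q. \<exists>i. \<tau> = (h ^^ i) \<tau>\<^sub>0))"

section \<open>Representations\<close>

definition representation :: "'a set \<Rightarrow> ('a \<Rightarrow> 's tape) \<Rightarrow> bool" where
  "representation A x \<longleftrightarrow> inj_on x A"

text \<open>Functions with domain \<open>A\<close> are extensional, so that equality of sets of such
  functions does not depend on values outside \<open>A\<close>.\<close>

definition comp_funs :: "'s tape set \<Rightarrow> 'a set \<Rightarrow> ('a \<Rightarrow> 's tape) \<Rightarrow> ('a \<Rightarrow> 'a) set" where
  "comp_funs R A x =
     {g \<in> A \<rightarrow>\<^sub>E A. computable_on R (x ` A) (x \<circ> g \<circ> the_inv_into A x)}"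

definition transformationally_equivalent ::
  "'s tape set \<Rightarrow> 'a set \<Rightarrow> ('a \<Rightarrow> 's tape) \<Rightarrow> ('a \<Rightarrow> 's tape) \<Rightarrow> bool" where
  "transformationally_equivalent R A x y \<longleftrightarrow>
     computable_on R (x ` A) (y \<circ> the_inv_into A x) \<and>
     computable_on R (y ` A) (x \<circ> the_inv_into A y)"

end

theory Submission
  imports Defs
begin

text \<open>An enumeration \<open>h\<close> of \<open>x ` A\<close> from \<open>x a\<close> represents a function
  \<open>g\<close> on \<open>A\<close> whose orbit of \<open>a\<close> is all of \<open>A\<close>. By assumption
  \<open>g\<close> is represented under \<open>y\<close> by a computable \<open>h'\<close>, which enumerates
  \<open>y ` A\<close> from \<open>y a\<close>. To translate \<open>x b\<close> into \<open>y b\<close>, a machine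
  iterates \<open>h\<close> and \<open>h'\<close> side by side until the first orbit reaches the input.
  Conjugation with these translations gives the equality of the sets of computable functions.\<close>

section \<open>Composing machines\<close>

text \<open>The inclusion is applied to a single function, the conjugate \<open>g\<close> of the
  enumeration \<open>h\<close>. Both orbits are images of the one sequence
  \<open>(g ^^ i) a\<close>, so the first index at which the orbit under \<open>h\<close> meets the
  input already selects the right point of the other orbit, even if orbits revisit points. The
  obstacle is to produce this search as an actual list of actions. Machines are therefore specified
  by relations between tape contents, with preconditions as conjuncts, and the realizable relations
  are shown to be closed under sequence, branching, loops and renaming of tapes. The search is a
  program in this small language over five primitives: write a constant tape, call a subroutine,
  compare, copy, erase. The strict form of \<open>halts_with\<close> works both ways: a called
  subroutine hands back its scratch tapes blank, which makes calls composable, but the search has to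
  clean up as well. Sweeps over whole tapes are possible because \<open>Outside\<close> marks where
  a tape ends.\<close>

definition reaches :: "'s tape set \<Rightarrow> 's machine \<Rightarrow> 's config \<Rightarrow> 's config \<Rightarrow> bool" where
  "reaches R M a b \<longleftrightarrow> (\<exists>n. (step R M ^^ n) a = b)"

lemma reaches_refl: "reaches R M a a"
  unfolding reaches_def by (rule exI[of _ 0]) simp

lemma reaches_step: "step R M a = b \<Longrightarrow> reaches R M a b"
  unfolding reaches_def by (rule exI[of _ 1]) simp

lemma reaches_trans: "reaches R M a b \<Longrightarrow> reaches R M b c \<Longrightarrow> reaches R M a c"
  unfolding reaches_def by (metis comp_apply funpow_add)

section \<open>Embedding a machine into a larger one\<close>

fun reloc :: "(nat \<Rightarrow> nat) \<Rightarrow> (nat \<Rightarrow> nat) \<Rightarrow> 's action \<Rightarrow> 's action" where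
  "reloc g \<rho> (Act k \<delta>) = Act (\<rho> k) (\<lambda>a. case \<delta> a of (q, b, d) \<Rightarrow> (g q, b, d))"
| "reloc g \<rho> (Query k p q) = Query (\<rho> k) (g p) (g q)"

text \<open>Injectivity of \<open>\<rho>\<close> keeps tapes apart: a write on tape
  \<open>\<rho> k\<close> is seen through \<open>c \<circ> \<rho>\<close> only at index
  \<open>k\<close>. Every action looks at one tape only, so a step commutes with the
  renaming.\<close>

lemma step_reloc:
  assumes "inj \<rho>" "q < length M" "r < length T" "T ! r = reloc g \<rho> (M ! q)"
    and "step R M (q, c \<circ> \<rho>) = (q', d)"
  shows "\<exists>c'. step R T (r, c) = (g q', c') \<and> c' \<circ> \<rho> = d \<and> (\<forall>k. k \<notin> range \<rho> \<longrightarrow> c' k = c k)"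
proof (cases "M ! q")
  case (Act k \<delta>)
  obtain q1 b m where \<delta>: "\<delta> (c (\<rho> k) 0) = (q1, b, m)" by (metis prod_cases3)
  let ?t = "\<lambda>i. ((c (\<rho> k))(0 := b)) (i + offset m)"
  have d: "d = (c \<circ> \<rho>)(k := ?t)" "q' = q1"
    using assms(2,5) Act \<delta> by auto
  have "step R T (r, c) = (g q', c(\<rho> k := ?t))"
    using assms(3,4) Act \<delta> d by simp
  moreover have "c(\<rho> k := ?t) \<circ> \<rho> = d"
    unfolding d using assms(1) by (simp add: fun_eq_iff inj_eq)
  ultimately show ?thesis by (intro exI[of _ "c(\<rho> k := ?t)"]) auto
next
  case (Query k p p')
  then show ?thesis
    using assms(2-5) by (intro exI[of _ c]) (auto split: if_splits)
qed

text \<open>A machine may halt in any state beyond its list. All of these are redirected to the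
  single exit \<open>e\<close>, so that whatever follows has one entry point.\<close>

definition part_of :: "'s machine \<Rightarrow> nat \<Rightarrow> nat \<Rightarrow> (nat \<Rightarrow> nat) \<Rightarrow> 's machine \<Rightarrow> bool" where
  "part_of M p e \<rho> T \<longleftrightarrow> inj \<rho> \<and> (\<forall>i<length M. p + i < length T \<and>
     T ! (p + i) = reloc (\<lambda>q. if q < length M then p + q else e) \<rho> (M ! i))"

lemma part_of_run:
  assumes "part_of M p e \<rho> T" "(step R M ^^ n) (q, c \<circ> \<rho>) = (q', d)" "length M \<le> q'"
  shows "\<exists>c'. reaches R T (if q < length M then p + q else e, c) (e, c') \<and> c' \<circ> \<rho> = d \<and>
    (\<forall>k. k \<notin> range \<rho> \<longrightarrow> c' k = c k)"
  using assms(2)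
proof (induction n arbitrary: q c)
  case 0
  then have "\<not> q < length M" "d = c \<circ> \<rho>" using assms(3) by auto
  then show ?case by (intro exI[of _ c]) (simp add: reaches_refl)
next
  case (Suc n)
  obtain q1 d1 where s: "step R M (q, c \<circ> \<rho>) = (q1, d1)" by (metis surj_pair)
  have n: "(step R M ^^ n) (q1, d1) = (q', d)"
    using Suc.prems s by (metis comp_apply funpow_Suc_right)
  show ?case
  proof (cases "q < length M")
    case True
    let ?g = "\<lambda>q. if q < length M then p + q else e"
    have p: "inj \<rho>" "p + q < length T" "T ! (p + q) = reloc ?g \<rho> (M ! q)"
      using assms(1) True by (auto simp: part_of_def)
    from step_reloc[OF p(1) True p(2,3) s] obtain c1 where
      c1: "step R T (p + q, c) = (?g q1, c1)" "c1 \<circ> \<rho> = d1" "\<forall>k. k \<notin> range \<rho> \<longrightarrow> c1 k = c k"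
      by blast
    have "(step R M ^^ n) (q1, c1 \<circ> \<rho>) = (q', d)" using n c1(2) by simp
    from Suc.IH[OF this] obtain c' where
      "reaches R T (?g q1, c1) (e, c')" "c' \<circ> \<rho> = d" "\<forall>k. k \<notin> range \<rho> \<longrightarrow> c' k = c1 k"
      by blast
    moreover have "reaches R T (p + q, c) (e, c')"
      using c1(1) calculation(1) by (blast intro: reaches_step reaches_trans)
    ultimately show ?thesis using c1(3) True by auto
  next
    \<comment> \<open>A halted \<open>M\<close> idles, while \<open>T\<close> already stands at
      \<open>e\<close> and makes no step for it.\<close>
    case False
    with s have "q1 = q" "d1 = c \<circ> \<rho>" by auto
    with n have "(step R M ^^ n) (q, c \<circ> \<rho>) = (q', d)" by simp
    then show ?thesis by (rule Suc.IH)
  qed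
qed

definition runs :: "'s tape set \<Rightarrow> 's machine \<Rightarrow>
    (nat \<Rightarrow> int \<Rightarrow> 's cell) \<Rightarrow> (nat \<Rightarrow> int \<Rightarrow> 's cell) \<Rightarrow> bool" where
  "runs R M c c' \<longleftrightarrow> (\<exists>q\<ge>length M. reaches R M (0, c) (q, c'))"

lemma runs_Nil: "runs R [] c c' \<longleftrightarrow> c' = c"
proof -
  have "(step R [] ^^ n) (0, c) = (0, c)" for n
    by (induction n) auto
  then show ?thesis by (auto simp: runs_def reaches_def)
qed

text \<open>The last assumption covers the empty machine: it has halted from the start, so it
  contributes no action that could lead from \<open>p\<close> to \<open>e\<close>.\<close>

lemma runs_part_of:
  assumes "part_of M p e \<rho> T" "runs R M (c \<circ> \<rho>) (c' \<circ> \<rho>)" "\<And>k. k \<notin> range \<rho> \<Longrightarrow> c' k = c k"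
    and "M = [] \<Longrightarrow> p = e"
  shows "reaches R T (p, c) (e, c')"
proof -
  obtain n q where n: "(step R M ^^ n) (0, c \<circ> \<rho>) = (q, c' \<circ> \<rho>)" "length M \<le> q"
    using assms(2) by (auto simp: runs_def reaches_def)
  from part_of_run[OF assms(1) n] obtain c1 where
    c1: "reaches R T (if 0 < length M then p + 0 else e, c) (e, c1)" "c1 \<circ> \<rho> = c' \<circ> \<rho>"
      "\<forall>k. k \<notin> range \<rho> \<longrightarrow> c1 k = c k"
    by blast
  have "c1 = c'"
  proof
    fix k show "c1 k = c' k"
    proof (cases "k \<in> range \<rho>")
      case True
      with c1(2) show ?thesis by (auto dest: fun_cong)
    qed (use c1(3) assms(3) in auto)
  qed
  with c1(1) assms(4) show ?thesis by (cases "M = []") auto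
qed

abbreviation place :: "nat \<Rightarrow> nat \<Rightarrow> 's machine \<Rightarrow> 's machine" where
  "place p e M \<equiv> map (reloc (\<lambda>q. if q < length M then p + q else e) id) M"

lemma part_of_place: "part_of M (length U) e id (U @ place (length U) e M @ V)"
  by (auto simp: part_of_def nth_append)

lemma runs_place:
  assumes "runs R M c c'" "length U = p" "M = [] \<Longrightarrow> p = e"
  shows "reaches R (U @ place p e M @ V) (p, c) (e, c')"
  using runs_part_of[OF part_of_place, of R M c c' U e V] assms by auto

section \<open>Programs as realizable relations\<close>

text \<open>Machines are deterministic, so only partial functions are realizable.\<close>

definition realizable :: "'s tape set \<Rightarrow>
    ((nat \<Rightarrow> int \<Rightarrow> 's cell) \<Rightarrow> (nat \<Rightarrow> int \<Rightarrow> 's cell) \<Rightarrow> bool) \<Rightarrow> bool" where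
  "realizable R T \<longleftrightarrow> (\<exists>M. \<forall>c c'. T c c' \<longrightarrow> runs R M c c')"

text \<open>Since preconditions are conjuncts of the relation, a smaller relation is a weaker
  demand. Concrete programs are obtained by chaining building blocks and then shrinking the
  composite relation to the intended one.\<close>

lemma realizable_mono:
  "realizable R T \<Longrightarrow> (\<And>c c'. U c c' \<Longrightarrow> T c c') \<Longrightarrow> realizable R U"
  unfolding realizable_def by blast

lemma realizable_skip: "realizable R (=)"
  unfolding realizable_def runs_def
  by (rule exI[of _ "[]"]) (auto intro: reaches_refl)

lemma realizable_act:
  "realizable R (\<lambda>c c'. c' = c(k := (\<lambda>i. ((c k)(0 := w (c k 0))) (i + offset d))))"
proof -
  have "runs R [Act k (\<lambda>a. (1, w a, d))] c (c(k := (\<lambda>i. ((c k)(0 := w (c k 0))) (i + offset d))))"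
    for c
    unfolding runs_def by (rule exI[of _ 1]) (auto intro!: reaches_step)
  then show ?thesis unfolding realizable_def by blast
qed

lemma realizable_seq:
  assumes "realizable R T" "realizable R U"
  shows "realizable R (T OO U)"
proof -
  obtain M N where M: "\<And>c c'. T c c' \<Longrightarrow> runs R M c c'" and N: "\<And>c c'. U c c' \<Longrightarrow> runs R N c c'"
    using assms unfolding realizable_def by blast
  let ?l = "length M" and ?e = "length M + length N"
  let ?S = "place 0 ?l M @ place ?l ?e N"
  have "runs R ?S c c''" if "T c c'" "U c' c''" for c c' c''
  proof -
    have "reaches R ?S (0, c) (?l, c')"
      using runs_place[OF M[OF that(1)], of "[]" 0 ?l "place ?l ?e N"] by simp
    moreover have "reaches R ?S (?l, c') (?e, c'')"
      using runs_place[OF N[OF that(2)], of "place 0 ?l M" ?l ?e "[]"] by simp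
    ultimately have "reaches R ?S (0, c) (?e, c'')" by (rule reaches_trans)
    then show ?thesis unfolding runs_def by (intro exI[of _ ?e]) simp
  qed
  then show ?thesis unfolding realizable_def by (intro exI[of _ ?S]) (auto simp: OO_def)
qed

lemma realizable_fun_seq:
  assumes "realizable R (\<lambda>c c'. c' = F c)" "realizable R (\<lambda>c c'. c' = G c)"
    and "\<And>c. H c = G (F c)"
  shows "realizable R (\<lambda>c c'. c' = H c)"
  by (rule realizable_mono[OF realizable_seq[OF assms(1,2)]]) (use assms(3) in blast)

lemma realizable_if:
  assumes "realizable R T" "realizable R U"
  shows "realizable R (\<lambda>c c'. if c k 0 \<in> S then T c c' else U c c')"
proof -
  obtain M N where M: "\<And>c c'. T c c' \<Longrightarrow> runs R M c c'" and N: "\<And>c c'. U c c' \<Longrightarrow> runs R N c c'"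
    using assms unfolding realizable_def by blast
  let ?l = "Suc (length M)" and ?e = "Suc (length M + length N)"
  \<comment> \<open>The test writes back what it scans and stays, so it changes only the state. If
    \<open>M\<close> is empty, state 1 is where \<open>N\<close> begins, hence the direct jump to
    the exit.\<close>
  let ?t = "Act k (\<lambda>a. (if a \<in> S then if M = [] then ?e else 1 else ?l, a, Stay))"
  let ?S = "[?t] @ place 1 ?e M @ place ?l ?e N"
  have t: "reaches R ?S (0, c) (if c k 0 \<in> S then if M = [] then ?e else 1 else ?l, c)" for c
    by (rule reaches_step) (auto simp: fun_eq_iff)
  have "runs R ?S c c'" if "if c k 0 \<in> S then T c c' else U c c'" for c c'
  proof -
    have "reaches R ?S (0, c) (?e, c')"
    proof (cases "c k 0 \<in> S")
      case True
      then have r: "runs R M c c'" using M that by simp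
      show ?thesis
      proof (cases "M = []")
        case True
        then have "c' = c" using r
          by (simp add: runs_Nil)
        then show ?thesis using t[of c] True \<open>c k 0 \<in> S\<close> by (simp only: if_True simp_thms)
      next
        case False
        have "reaches R ?S (1, c) (?e, c')"
          using runs_place[OF r, of "[?t]" 1 ?e "place ?l ?e N"] False by simp
        moreover have "reaches R ?S (0, c) (1, c)"
          using t[of c] True False by (simp only: if_True if_False)
        ultimately show ?thesis by (rule reaches_trans[rotated])
      qed
    next
      case False
      then have "runs R N c c'" using N that by simp
      then have "reaches R ?S (?l, c) (?e, c')"
        using runs_place[of R N c c' "[?t] @ place 1 ?e M" ?l ?e "[]"] by simp
      moreover have "reaches R ?S (0, c) (?l, c)"
        using t[of c] False by (simp only: if_False)
      ultimately show ?thesis by (rule reaches_trans[rotated])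
    qed
    then show ?thesis unfolding runs_def by (intro exI[of _ ?e]) simp
  qed
  then show ?thesis unfolding realizable_def by (intro exI[of _ ?S] allI impI) blast
qed

text \<open>Only configurations reached after finitely many rounds are related, so termination is
  left to the caller, who has to exhibit the chain of rounds. The exit of the body is state 0, the
  test itself.\<close>

lemma realizable_while:
  assumes "realizable R T"
  shows "realizable R (\<lambda>c c'. (\<lambda>c c'. c k 0 \<in> S \<and> T c c')\<^sup>*\<^sup>* c c' \<and> c' k 0 \<notin> S)"
proof -
  obtain M where M: "\<And>c c'. T c c' \<Longrightarrow> runs R M c c'"
    using assms unfolding realizable_def by blast
  let ?e = "Suc (length M)"
  let ?t = "Act k (\<lambda>a. (if a \<in> S then if M = [] then 0 else 1 else ?e, a, Stay))"
  let ?S = "[?t] @ place 1 0 M @ []"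
  have t: "reaches R ?S (0, c) (if c k 0 \<in> S then if M = [] then 0 else 1 else ?e, c)" for c
    by (rule reaches_step) (auto simp: fun_eq_iff)
  have b: "reaches R ?S (0, c) (0, c')" if "c k 0 \<in> S" "T c c'" for c c'
  proof (cases "M = []")
    case True
    then have "c' = c" using M[OF that(2)]
      by (simp add: runs_Nil)
    then show ?thesis by (simp add: reaches_refl)
  next
    case False
    have "reaches R ?S (1, c) (0, c')"
      using runs_place[OF M[OF that(2)], of "[?t]" 1 0 "[]"] False by simp
    moreover have "reaches R ?S (0, c) (1, c)"
      using t[of c] that(1) False by (simp only: if_True if_False)
    ultimately show ?thesis by (rule reaches_trans[rotated])
  qed
  have "runs R ?S c c'"
    if "(\<lambda>c c'. c k 0 \<in> S \<and> T c c')\<^sup>*\<^sup>* c c'" "c' k 0 \<notin> S" for c c'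
  proof -
    have "reaches R ?S (0, c) (0, c')"
      using that(1) by induction (blast intro: reaches_refl reaches_trans b)+
    moreover have "reaches R ?S (0, c') (?e, c')"
      using t[of c'] that(2) by (simp only: if_False)
    ultimately have "reaches R ?S (0, c) (?e, c')"
      by (rule reaches_trans)
    then show ?thesis unfolding runs_def by (intro exI[of _ ?e]) simp
  qed
  then show ?thesis unfolding realizable_def by (intro exI[of _ ?S] allI impI) blast
qed

lemma realizable_rename:
  assumes "realizable R T" "inj \<rho>"
  shows "realizable R (\<lambda>c c'. T (c \<circ> \<rho>) (c' \<circ> \<rho>) \<and> (\<forall>k. k \<notin> range \<rho> \<longrightarrow> c' k = c k))"
proof -
  obtain M where M: "\<And>c c'. T c c' \<Longrightarrow> runs R M c c'"
    using assms unfolding realizable_def by blast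
  let ?S = "map (reloc (\<lambda>q. if q < length M then 0 + q else length M) \<rho>) M"
  have p: "part_of M 0 (length M) \<rho> ?S" using assms(2) by (auto simp: part_of_def)
  have "runs R ?S c c'" if "T (c \<circ> \<rho>) (c' \<circ> \<rho>)" "\<forall>k. k \<notin> range \<rho> \<longrightarrow> c' k = c k" for c c'
    using runs_part_of[OF p M[OF that(1)]] that(2) unfolding runs_def
    by (intro exI[of _ "length M"]) auto
  then show ?thesis unfolding realizable_def by blast
qed

lemma finite_cells: "finite (UNIV :: 's::finite cell set)"
proof -
  have "(UNIV :: 's cell set) = insert Outside (range Cell)" by (auto intro: cell.exhaust)
  then show ?thesis by (metis finite finite_imageI finite_insert)
qed

text \<open>An action sees a single tape. To let a symbol on tape \<open>k\<close> influence other
  tapes, the control state has to remember it: one branch per symbol, finitely many because the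
  alphabet is finite.\<close>

lemma realizable_case:
  fixes T :: "'s::finite cell \<Rightarrow> _"
  assumes "\<And>a. realizable R (T a)"
  shows "realizable R (\<lambda>c. T (c k 0) c)"
proof -
  have "realizable R (\<lambda>c c'. c k 0 \<in> X \<and> T (c k 0) c c')" if "finite X" for X
    using that
  proof induction
    case empty
    show ?case by (rule realizable_mono[OF realizable_skip]) simp
  next
    case (insert a X)
    show ?case
      by (rule realizable_mono[OF realizable_if[OF assms[of a] insert.IH, of k "{a}"]]) auto
  qed
  from this[OF finite_cells] show ?thesis by simp
qed

section \<open>Sweeping over a tape\<close>

definition shift :: "nat set \<Rightarrow> int \<Rightarrow> (nat \<Rightarrow> int \<Rightarrow> 'c) \<Rightarrow> nat \<Rightarrow> int \<Rightarrow> 'c" where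
  "shift K z c = (\<lambda>k i. if k \<in> K then c k (i + z) else c k i)"

lemma shift_shift: "shift K z (shift K z' c) = shift K (z + z') c"
  by (auto simp: shift_def fun_eq_iff ac_simps)

lemma shift_0: "shift K 0 c = c"
  by (simp add: shift_def fun_eq_iff)

lemma realizable_shift:
  assumes "finite K"
  shows "realizable R (\<lambda>c c'. c' = shift K z c)"
proof -
  have move: "realizable R (\<lambda>c c'. c' = shift K (offset d) c)" for d
    using assms
  proof induction
    case empty
    show ?case by (rule realizable_mono[OF realizable_skip]) (simp add: shift_def)
  next
    case (insert k K)
    show ?case
      by (rule realizable_fun_seq[OF insert.IH realizable_act[of R k "\<lambda>a. a" d]])
        (use insert.hyps in \<open>auto simp: shift_def fun_eq_iff\<close>)
  qed
  show ?thesis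
  proof (induction z rule: int_induct[of _ 0])
    case base
    show ?case by (rule realizable_mono[OF realizable_skip]) (simp add: shift_0)
  next
    case (step1 z)
    show ?case
      by (rule realizable_fun_seq[OF step1.IH move[of Right]])
        (simp add: shift_shift add.commute)
  next
    case (step2 z)
    show ?case
      by (rule realizable_fun_seq[OF step2.IH move[of Left]]) (simp add: shift_shift)
  qed
qed

lemma realizable_put: "realizable R (\<lambda>c c'. c' = c(k := (c k)(z := a)))"
proof -
  have zero: "realizable R (\<lambda>c c'. c' = c(k := (c k)(0 := a)))"
    using realizable_act[of R k "\<lambda>_. a" Stay] by (simp add: fun_upd_def)
  show ?thesis
    by (rule realizable_fun_seq[OF realizable_fun_seq[OF realizable_shift[of "{k}" R z] zero refl]
          realizable_shift[of "{k}" R "- z"]])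
      (auto simp: shift_def fun_eq_iff)
qed

text \<open>Knowing the old content \<open>t\<close> in advance, the machine visits only the cells
  where \<open>u\<close> differs, and these finitely many writes can be built into it.\<close>

lemma realizable_put_finite:
  assumes "finite {z. t z \<noteq> u z}"
  shows "realizable R (\<lambda>c c'. c k = t \<and> c' = c(k := u))"
proof -
  have "realizable R (\<lambda>c c'. c' = c(k := (\<lambda>z. if z \<in> Z then u z else c k z)))" if "finite Z" for Z
    using that
  proof induction
    case empty
    show ?case by (rule realizable_mono[OF realizable_skip]) simp
  next
    case (insert z Z)
    show ?case
      by (rule realizable_fun_seq[OF insert.IH realizable_put[of R k z "u z"]])
        (auto simp: fun_eq_iff)
  qed
  from this[OF assms] show ?thesis
    by (rule realizable_mono) (auto simp: fun_eq_iff)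
qed

section \<open>The shape of loaded tapes\<close>

lemma load_fmempty: "load fmempty i = (if i = 0 then Cell None else Outside)"
  by (auto simp: load_def)

lemma load_interval: "\<exists>l r. l \<le> 0 \<and> 0 \<le> r \<and> (\<forall>i. load \<tau> i = Outside \<longleftrightarrow> i \<notin> {l..r})"
proof -
  let ?S = "insert 0 (fset (fmdom \<tau>))"
  have "load \<tau> i = Outside \<longleftrightarrow> i \<notin> {Min ?S..Max ?S}" for i
    unfolding load_def Let_def by simp
  moreover have "Min ?S \<le> 0" "0 \<le> Max ?S" by auto
  ultimately show ?thesis by blast
qed

text \<open>Here \<open>s\<close> is a direction, 1 or -1, and \<open>n\<close> counts the cells of
  the ray before \<open>Outside\<close>, the head cell included. The equivalence also excludes
  gaps.\<close>

definition ends_at :: "int \<Rightarrow> (int \<Rightarrow> 's cell) \<Rightarrow> nat \<Rightarrow> bool" where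
  "ends_at s a n \<longleftrightarrow> (\<forall>t::nat. a (s * int t) = Outside \<longleftrightarrow> n \<le> t)"

lemma ends_at_load:
  assumes "s = 1 \<or> s = -1"
  shows "\<exists>n. ends_at s (load \<tau>) n"
proof -
  obtain l r where lr: "l \<le> 0" "0 \<le> r" "\<forall>i. load \<tau> i = Outside \<longleftrightarrow> i \<notin> {l..r}"
    using load_interval[of \<tau>] by (elim exE conjE)
  have "ends_at s (load \<tau>) (nat (if s = 1 then r + 1 else 1 - l))"
    unfolding ends_at_def lr(3)[rule_format] using assms lr(1,2) by auto
  then show ?thesis ..
qed

lemma finite_load: "finite {i. load \<tau> i \<noteq> Outside}"
proof -
  obtain l r where lr: "\<forall>i. load \<tau> i = Outside \<longleftrightarrow> i \<notin> {l..r}"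
    using load_interval[of \<tau>] by (elim exE conjE)
  show ?thesis unfolding lr[rule_format] by simp
qed

lemma load_lookup: "(case load \<tau> i of Outside \<Rightarrow> None | Cell s \<Rightarrow> s) = fmlookup \<tau> i"
proof (cases "i \<in> fset (fmdom \<tau>)")
  case True
  then show ?thesis by (simp add: load_def Let_def)
next
  case False
  then show ?thesis by (simp add: load_def Let_def fmdom_notD)
qed

lemma inj_load: "inj load"
  by (rule injI, rule fmap_ext) (metis load_lookup)

lemma shift_at: "k \<in> K \<Longrightarrow> shift K z c k i = c k (i + z)"
  by (simp add: shift_def)

text \<open>The blank tape \<open>m\<close> moves in step with the tapes that are worked on and so
  remembers where the sweep started: its only \<open>Cell None\<close> is at index 0.\<close>

lemma realizable_sweep:
  assumes "realizable R T" "finite K" "m \<in> K" "k \<in> K" "s \<noteq> 0"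
  shows "realizable R (\<lambda>c c'. \<exists>n C. c = C 0 \<and> c' = C (Suc n) \<and>
    (\<forall>t\<le>n. T (shift K (s * int t) (C t)) (shift K (s * int t) (C (Suc t)))) \<and>
    (\<forall>t<n. C t k (s * int t) \<noteq> Outside) \<and> C n k (s * int n) = Outside \<and>
    C (Suc n) m = load fmempty)"
proof -
  \<comment> \<open>\<open>C t\<close> describes the tapes in coordinates fixed at the start of the
    sweep; the actual configuration in round \<open>t\<close> is its shift by
    \<open>s * int t\<close>. After the loop \<open>?W\<close>, \<open>T\<close> acts once more on
    the first \<open>Outside\<close> cell, hence \<open>C (Suc n)\<close>; then \<open>?V\<close>
    walks back.\<close>
  let ?W = "\<lambda>c c'. c k 0 \<in> - {Outside} \<and> (T OO (\<lambda>c c'. c' = shift K s c)) c c'"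
  let ?V = "\<lambda>c c'. c m 0 \<in> - {Cell None} \<and> c' = shift K (- s) c"
  have "realizable R ((\<lambda>c c'. ?W\<^sup>*\<^sup>* c c' \<and> c' k 0 \<notin> - {Outside}) OO T OO
    (\<lambda>c c'. ?V\<^sup>*\<^sup>* c c' \<and> c' m 0 \<notin> - {Cell None}))"
    by (intro realizable_seq realizable_while realizable_shift assms)
  then show ?thesis
  proof (rule realizable_mono)
    fix c c'
    assume "\<exists>n C. c = C 0 \<and> c' = C (Suc n) \<and>
      (\<forall>t\<le>n. T (shift K (s * int t) (C t)) (shift K (s * int t) (C (Suc t)))) \<and>
      (\<forall>t<n. C t k (s * int t) \<noteq> Outside) \<and> C n k (s * int n) = Outside \<and>
      C (Suc n) m = load fmempty"
    then obtain n C where c: "c = C 0" "c' = C (Suc n)"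
      and T: "\<And>t. t \<le> n \<Longrightarrow> T (shift K (s * int t) (C t)) (shift K (s * int t) (C (Suc t)))"
      and k: "\<And>t. t < n \<Longrightarrow> C t k (s * int t) \<noteq> Outside" "C n k (s * int n) = Outside"
      and m: "C (Suc n) m = load fmempty"
      by auto
    have "?W\<^sup>*\<^sup>* c (shift K (s * int t) (C t))" if "t \<le> n" for t
      using that
    proof (induction t)
      case 0
      then show ?case by (simp add: c shift_0)
    next
      case (Suc t)
      have "T (shift K (s * int t) (C t)) (shift K (s * int t) (C (Suc t)))"
        using T Suc.prems by simp
      moreover have "shift K (s * int (Suc t)) (C (Suc t)) = shift K s (shift K (s * int t) (C (Suc t)))"
        by (simp add: shift_shift algebra_simps)
      moreover have "shift K (s * int t) (C t) k 0 \<in> - {Outside}"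
        using k(1) Suc.prems assms(4) by (simp add: shift_at)
      ultimately have "?W (shift K (s * int t) (C t)) (shift K (s * int (Suc t)) (C (Suc t)))"
        by blast
      moreover have "?W\<^sup>*\<^sup>* c (shift K (s * int t) (C t))" using Suc by simp
      ultimately show ?case by (rule rtranclp.rtrancl_into_rtrancl[rotated])
    qed
    from this[of n]
    have "?W\<^sup>*\<^sup>* c (shift K (s * int n) (C n)) \<and> shift K (s * int n) (C n) k 0 \<notin> - {Outside}"
      using k(2) assms(4) by (simp add: shift_at)
    moreover have "T (shift K (s * int n) (C n)) (shift K (s * int n) (C (Suc n)))"
      using T by simp
    moreover have "?V\<^sup>*\<^sup>* (shift K (s * int t) (C (Suc n))) (C (Suc n))" for t
    proof (induction t)
      case 0
      then show ?case by (simp add: shift_0)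
    next
      case (Suc t)
      have "?V (shift K (s * int (Suc t)) (C (Suc n))) (shift K (s * int t) (C (Suc n)))"
      proof
        have "s * int (Suc t) \<noteq> 0" using assms(5) by simp
        then show "shift K (s * int (Suc t)) (C (Suc n)) m 0 \<in> - {Cell None}"
          using assms(3) m by (simp only: shift_at load_fmempty) simp
        show "shift K (s * int t) (C (Suc n)) = shift K (- s) (shift K (s * int (Suc t)) (C (Suc n)))"
          by (simp add: shift_shift algebra_simps)
      qed
      then show ?case using Suc.IH by (rule converse_rtranclp_into_rtranclp)
    qed
    from this[of n] have "?V\<^sup>*\<^sup>* (shift K (s * int n) (C (Suc n))) c' \<and> c' m 0 \<notin> - {Cell None}"
      using m by (simp add: c load_fmempty)
    ultimately show "((\<lambda>c c'. ?W\<^sup>*\<^sup>* c c' \<and> c' k 0 \<notin> - {Outside}) OO T OO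
      (\<lambda>c c'. ?V\<^sup>*\<^sup>* c c' \<and> c' m 0 \<notin> - {Cell None})) c c'"
      by blast
  qed
qed

section \<open>Erasing, copying and comparing tapes, ray by ray\<close>

lemma tape_eqI:
  assumes "\<And>t::nat. a (1 * int t) = b (1 * int t)" "\<And>t::nat. a (-1 * int t) = b (-1 * int t)"
  shows "a = (b :: int \<Rightarrow> 'c)"
proof
  fix i show "a i = b i"
    using assms(1)[of "nat i"] assms(2)[of "nat (- i)"] by (cases "0 \<le> i") auto
qed

text \<open>The head cell is refilled with \<open>Cell None\<close>: a loaded blank tape has this
  cell, and the sweep in the opposite direction must not find \<open>Outside\<close> at its very
  start.\<close>

lemma realizable_erase_ray:
  assumes "s = 1 \<or> s = -1" "m \<noteq> k"
  shows "realizable R (\<lambda>c c'. \<exists>n. ends_at s (c k) n \<and> c m = load fmempty \<and>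
    c' = c(k := (\<lambda>i. if i = 0 then Cell None else if \<exists>t::nat. i = s * int t then Outside else c k i)))"
proof -
  have s: "s \<noteq> 0" using assms by auto
  show ?thesis
  proof (rule realizable_mono[OF realizable_seq[OF realizable_sweep[OF realizable_put[of R k 0 Outside],
            of "{k, m}" m k s] realizable_put[of R k 0 "Cell None"]]])
    fix c c'
    assume "\<exists>n. ends_at s (c k) n \<and> c m = load fmempty \<and>
      c' = c(k := (\<lambda>i. if i = 0 then Cell None else if \<exists>t::nat. i = s * int t then Outside else c k i))"
    then obtain n where n: "\<And>t. c k (s * int t) = Outside \<longleftrightarrow> n \<le> t" and m: "c m = load fmempty"
      and c': "c' = c(k := (\<lambda>i. if i = 0 then Cell None else
        if \<exists>t::nat. i = s * int t then Outside else c k i))"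
      unfolding ends_at_def by blast
    \<comment> \<open>Round \<open>t\<close> tests cell \<open>t\<close> before erasing it, so the
      loop condition still sees the original content.\<close>
    define C where "C t = c(k := (\<lambda>i. if \<exists>t'<t. i = s * int t' then Outside else c k i))" for t
    have "C 0 = c" by (simp add: C_def)
    moreover have "shift {k, m} (s * int t) (C (Suc t)) =
      (shift {k, m} (s * int t) (C t))(k := (shift {k, m} (s * int t) (C t) k)(0 := Outside))" for t
      using assms(2) by (auto simp: C_def shift_def fun_eq_iff less_Suc_eq)
    moreover have "C t k (s * int t) = c k (s * int t)" for t
      using s by (simp add: C_def)
    moreover have "C (Suc n) m = load fmempty"
      using assms(2) m by (simp add: C_def)
    moreover have "c' = (C (Suc n))(k := (C (Suc n) k)(0 := Cell None))"
      using n by (auto simp: C_def c' fun_eq_iff) (metis less_Suc_eq_le nat_le_linear)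
    ultimately show "((\<lambda>c c'. \<exists>n C. c = C 0 \<and> c' = C (Suc n) \<and>
      (\<forall>t\<le>n. shift {k, m} (s * int t) (C (Suc t)) = (shift {k, m} (s * int t) (C t))
         (k := (shift {k, m} (s * int t) (C t) k)(0 := Outside))) \<and>
      (\<forall>t<n. C t k (s * int t) \<noteq> Outside) \<and> C n k (s * int n) = Outside \<and>
      C (Suc n) m = load fmempty) OO (\<lambda>c c'. c' = c(k := (c k)(0 := Cell None)))) c c'"
      using n by (intro relcomppI[of _ _ "C (Suc n)"] exI[of _ n] exI[of _ C]) auto
  qed (use s in auto)
qed

lemma realizable_erase:
  assumes "m \<noteq> k"
  shows "realizable R (\<lambda>c c'. \<exists>\<tau>. c k = load \<tau> \<and> c m = load fmempty \<and> c' = c(k := load fmempty))"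
proof (rule realizable_mono[OF realizable_seq[OF realizable_erase_ray[of 1 m k]
        realizable_erase_ray[of "-1" m k]]])
  fix c c' :: "nat \<Rightarrow> int \<Rightarrow> 'a cell"
  assume "\<exists>\<tau>. c k = load \<tau> \<and> c m = load fmempty \<and> c' = c(k := load fmempty)"
  then obtain \<tau> where \<tau>: "c k = load \<tau>" "c m = load fmempty" "c' = c(k := load fmempty)" by blast
  obtain n1 where n1: "ends_at 1 (load \<tau>) n1" using ends_at_load[of 1 \<tau>] by auto
  obtain n2 where n2: "ends_at (-1) (load \<tau>) n2" using ends_at_load[of "-1" \<tau>] by auto
  let ?d = "c(k := (\<lambda>i. if i = 0 then Cell None else if \<exists>t::nat. i = 1 * int t then Outside else c k i))"
  \<comment> \<open>Hence \<open>n2\<close> is positive, and replacing the head cell by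
    \<open>Cell None\<close> does not change the length of the left ray.\<close>
  have "load \<tau> 0 \<noteq> Outside" by (simp add: load_def Let_def)
  then have "ends_at (-1) (?d k) n2"
    using n2 \<tau>(1) unfolding ends_at_def by (auto 0 3)
  moreover have "c' = ?d(k := (\<lambda>i. if i = 0 then Cell None else
      if \<exists>t::nat. i = -1 * int t then Outside else ?d k i))"
    unfolding \<tau>(3) by (auto simp: fun_eq_iff load_fmempty)
      (metis add.inverse_inverse int_cases2 minus_equation_iff)
  ultimately show "((\<lambda>c c'. \<exists>n. ends_at 1 (c k) n \<and> c m = load fmempty \<and>
    c' = c(k := (\<lambda>i. if i = 0 then Cell None else if \<exists>t::nat. i = 1 * int t then Outside else c k i)))
    OO (\<lambda>c c'. \<exists>n. ends_at (-1) (c k) n \<and> c m = load fmempty \<and>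
    c' = c(k := (\<lambda>i. if i = 0 then Cell None else if \<exists>t::nat. i = -1 * int t then Outside else c k i)))) c c'"
    using n1 \<tau> assms by (intro relcomppI[of _ _ ?d]) auto
qed (use assms in auto)

text \<open>The target must be \<open>Outside\<close> only for \<open>t > 0\<close>: when the second
  of the two sweeps begins, the first has already filled the head cell.\<close>

lemma realizable_copy_ray:
  fixes R :: "'s::finite tape set"
  assumes "s = 1 \<or> s = -1" "distinct [j, k, m]"
  shows "realizable R (\<lambda>c c'. \<exists>n. ends_at s (c k) n \<and> c m = load fmempty \<and>
    (\<forall>t>0. c j (s * int t) = Outside) \<and>
    c' = c(j := (\<lambda>i. if \<exists>t::nat. i = s * int t then c k i else c j i)))"
proof -
  have s: "s \<noteq> 0" using assms by auto
  have put: "realizable R (\<lambda>c c'. c' = c(j := (c j)(0 := c k 0)))"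
    using realizable_case[of R "\<lambda>a c c'. c' = c(j := (c j)(0 := a))" k] realizable_put[of R j 0] by simp
  show ?thesis
  proof (rule realizable_mono[OF realizable_sweep[OF put, of "{j, k, m}" m k s]])
    fix c c'
    assume "\<exists>n. ends_at s (c k) n \<and> c m = load fmempty \<and>
      (\<forall>t>0. c j (s * int t) = Outside) \<and>
      c' = c(j := (\<lambda>i. if \<exists>t::nat. i = s * int t then c k i else c j i))"
    then obtain n where n: "\<And>t. c k (s * int t) = Outside \<longleftrightarrow> n \<le> t" and m: "c m = load fmempty"
      and j: "\<And>t. t > 0 \<Longrightarrow> c j (s * int t) = Outside"
      and c': "c' = c(j := (\<lambda>i. if \<exists>t::nat. i = s * int t then c k i else c j i))"
      unfolding ends_at_def by blast
    define C where "C t = c(j := (\<lambda>i. if \<exists>t'<t. i = s * int t' then c k i else c j i))" for t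
    have "C 0 = c" by (simp add: C_def)
    moreover have "shift {j, k, m} (s * int t) (C (Suc t)) = (shift {j, k, m} (s * int t) (C t))
      (j := (shift {j, k, m} (s * int t) (C t) j)(0 := shift {j, k, m} (s * int t) (C t) k 0))" for t
      using assms(2) by (auto simp: C_def shift_def fun_eq_iff less_Suc_eq)
    moreover have "C t k = c k" for t
      using assms(2) by (simp add: C_def)
    moreover have "C (Suc n) m = load fmempty"
      using assms(2) m by (simp add: C_def)
    moreover have "C (Suc n) = c'"
    proof -
      \<comment> \<open>Cells past the end of the sweep are never written; they agree because both
        are \<open>Outside\<close>.\<close>
      have "c j (s * int t) = c k (s * int t)" if "\<not> t < Suc n" for t
        using n[of t] j[of t] that by simp
      then show ?thesis by (auto simp: C_def c' fun_eq_iff)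
    qed
    ultimately show "\<exists>n C. c = C 0 \<and> c' = C (Suc n) \<and>
      (\<forall>t\<le>n. shift {j, k, m} (s * int t) (C (Suc t)) = (shift {j, k, m} (s * int t) (C t))
         (j := (shift {j, k, m} (s * int t) (C t) j)(0 := shift {j, k, m} (s * int t) (C t) k 0))) \<and>
      (\<forall>t<n. C t k (s * int t) \<noteq> Outside) \<and> C n k (s * int n) = Outside \<and>
      C (Suc n) m = load fmempty"
      using n by (intro exI[of _ n] exI[of _ C]) auto
  qed (use s in auto)
qed

lemma realizable_copy:
  fixes R :: "'s::finite tape set"
  assumes "distinct [j, k, m]"
  shows "realizable R (\<lambda>c c'. \<exists>\<tau>. c k = load \<tau> \<and> c j = load fmempty \<and> c m = load fmempty \<and>
    c' = c(j := c k))"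
proof (rule realizable_mono[OF realizable_seq[OF realizable_copy_ray[of 1 j k m]
        realizable_copy_ray[of "-1" j k m]]])
  fix c c' :: "nat \<Rightarrow> int \<Rightarrow> 's cell"
  assume "\<exists>\<tau>. c k = load \<tau> \<and> c j = load fmempty \<and> c m = load fmempty \<and> c' = c(j := c k)"
  then obtain \<tau> where \<tau>: "c k = load \<tau>" "c j = load fmempty" "c m = load fmempty" "c' = c(j := c k)"
    by blast
  obtain n1 where n1: "ends_at 1 (load \<tau>) n1" using ends_at_load[of 1 \<tau>] by auto
  obtain n2 where n2: "ends_at (-1) (load \<tau>) n2" using ends_at_load[of "-1" \<tau>] by auto
  let ?d = "c(j := (\<lambda>i. if \<exists>t::nat. i = 1 * int t then c k i else c j i))"
  have j: "?d j (-1 * int t) = Outside" if "t > 0" for t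
    using that \<tau>(2) by (auto simp: load_fmempty)
  have "c' = ?d(j := (\<lambda>i. if \<exists>t::nat. i = -1 * int t then ?d k i else ?d j i))"
  proof -
    have "c k = (?d(j := (\<lambda>i. if \<exists>t::nat. i = -1 * int t then ?d k i else ?d j i))) j"
      using assms by (intro tape_eqI) auto
    then show ?thesis using \<tau>(4) by auto
  qed
  with j show "((\<lambda>c c'. \<exists>n. ends_at 1 (c k) n \<and> c m = load fmempty \<and>
      (\<forall>t>0. c j (1 * int t) = Outside) \<and>
      c' = c(j := (\<lambda>i. if \<exists>t::nat. i = 1 * int t then c k i else c j i)))
    OO (\<lambda>c c'. \<exists>n. ends_at (-1) (c k) n \<and> c m = load fmempty \<and>
      (\<forall>t>0. c j (-1 * int t) = Outside) \<and>
      c' = c(j := (\<lambda>i. if \<exists>t::nat. i = -1 * int t then c k i else c j i)))) c c'"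
    using n1 n2 \<tau> assms by (intro relcomppI[of _ _ ?d]) (auto simp: load_fmempty)
qed (use assms in auto)

text \<open>The flag is only ever turned to \<open>Outside\<close>, so the verdicts of successive
  sweeps are conjoined. Tape \<open>f\<close> does not move with the others, which keeps the flag
  under its head. The comparison at \<open>t = n\<close> exposes a tape \<open>j\<close> that is
  longer than tape \<open>k\<close>.\<close>

lemma realizable_compare_ray:
  fixes R :: "'s::finite tape set"
  assumes "s = 1 \<or> s = -1" "distinct [j, k, m, f]"
  shows "realizable R (\<lambda>c c'. \<exists>n. ends_at s (c k) n \<and> c m = load fmempty \<and>
    c' = c(f := (c f)(0 := if \<forall>t\<le>n. c j (s * int t) = c k (s * int t) then c f 0 else Outside)))"
proof -
  have s: "s \<noteq> 0" using assms by auto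
  have put: "realizable R (\<lambda>c c'. c' = c(f := (c f)(0 := if c j 0 = c k 0 then c f 0 else Outside)))"
  proof -
    have "realizable R (\<lambda>c c'. c' = c(f := (c f)(0 := if a = b then c f 0 else Outside)))" for a b
    proof (cases "a = b")
      case True
      then show ?thesis by (intro realizable_mono[OF realizable_skip]) simp
    next
      case False
      then show ?thesis using realizable_put[of R f 0 Outside] by simp
    qed
    from realizable_case[of R "\<lambda>b c c'. c' = c(f := (c f)(0 := if a = b then c f 0 else Outside))" k for a,
        OF this]
    have "realizable R (\<lambda>c c'. c' = c(f := (c f)(0 := if a = c k 0 then c f 0 else Outside)))" for a .
    from realizable_case[of R "\<lambda>a c c'. c' = c(f := (c f)(0 := if a = c k 0 then c f 0 else Outside))" j,
        OF this]
    show ?thesis .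
  qed
  show ?thesis
  proof (rule realizable_mono[OF realizable_sweep[OF put, of "{j, k, m}" m k s]])
    fix c c'
    assume "\<exists>n. ends_at s (c k) n \<and> c m = load fmempty \<and>
      c' = c(f := (c f)(0 := if \<forall>t\<le>n. c j (s * int t) = c k (s * int t) then c f 0 else Outside))"
    then obtain n where n: "\<And>t. c k (s * int t) = Outside \<longleftrightarrow> n \<le> t" and m: "c m = load fmempty"
      and c': "c' = c(f := (c f)(0 := if \<forall>t\<le>n. c j (s * int t) = c k (s * int t) then c f 0 else Outside))"
      unfolding ends_at_def by blast
    define C where "C t = c(f := (c f)
      (0 := if \<forall>t'<t. c j (s * int t') = c k (s * int t') then c f 0 else Outside))" for t
    let ?D = "\<lambda>t. shift {j, k, m} (s * int t) (C t)"
    have "C 0 = c" by (simp add: C_def)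
    moreover have "shift {j, k, m} (s * int t) (C (Suc t)) =
      (?D t)(f := (?D t f)(0 := if ?D t j 0 = ?D t k 0 then ?D t f 0 else Outside))" for t
      using assms(2) by (auto simp: C_def shift_def fun_eq_iff less_Suc_eq)
    moreover have "C t k = c k" for t
      using assms(2) by (simp add: C_def)
    moreover have "C (Suc n) m = load fmempty"
      using assms(2) m by (simp add: C_def)
    moreover have "C (Suc n) = c'"
      by (simp add: C_def c' less_Suc_eq_le)
    ultimately show "\<exists>n C. c = C 0 \<and> c' = C (Suc n) \<and>
      (\<forall>t\<le>n. shift {j, k, m} (s * int t) (C (Suc t)) = (shift {j, k, m} (s * int t) (C t))
         (f := (shift {j, k, m} (s * int t) (C t) f)
           (0 := if shift {j, k, m} (s * int t) (C t) j 0 = shift {j, k, m} (s * int t) (C t) k 0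
                 then shift {j, k, m} (s * int t) (C t) f 0 else Outside))) \<and>
      (\<forall>t<n. C t k (s * int t) \<noteq> Outside) \<and> C n k (s * int n) = Outside \<and>
      C (Suc n) m = load fmempty"
      using n by (intro exI[of _ n] exI[of _ C]) auto
  qed (use s in auto)
qed

text \<open>Agreement at \<open>t = n\<close> makes \<open>b\<close> \<open>Outside\<close> there as
  well, so \<open>n' \<le> n\<close> and both rays are \<open>Outside\<close> from then on. A finite
  check thus settles the whole ray.\<close>

lemma ends_at_eq:
  assumes "ends_at s a n" "ends_at s b n'" "\<forall>t\<le>n. b (s * int t) = a (s * int t)"
  shows "b (s * int t) = a (s * int t)"
proof (cases "t \<le> n")
  case False
  have "n' \<le> n" using assms unfolding ends_at_def by (metis order_refl)
  with False have "a (s * int t) = Outside" "b (s * int t) = Outside"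
    using assms(1,2) unfolding ends_at_def by auto
  then show ?thesis by simp
qed (use assms(3) in blast)

lemma realizable_compare:
  fixes R :: "'s::finite tape set"
  assumes "distinct [j, k, m, f]"
  shows "realizable R (\<lambda>c c'. \<exists>\<sigma> \<tau>. c j = load \<sigma> \<and> c k = load \<tau> \<and> c m = load fmempty \<and>
    c' = c(f := (c f)(0 := if \<sigma> = \<tau> then c f 0 else Outside)))"
proof (rule realizable_mono[OF realizable_seq[OF realizable_compare_ray[of 1 j k m f]
        realizable_compare_ray[of "-1" j k m f]]])
  fix c c' :: "nat \<Rightarrow> int \<Rightarrow> 's cell"
  assume "\<exists>\<sigma> \<tau>. c j = load \<sigma> \<and> c k = load \<tau> \<and> c m = load fmempty \<and>
    c' = c(f := (c f)(0 := if \<sigma> = \<tau> then c f 0 else Outside))"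
  then obtain \<sigma> \<tau> where \<tau>: "c j = load \<sigma>" "c k = load \<tau>" "c m = load fmempty"
    and c': "c' = c(f := (c f)(0 := if \<sigma> = \<tau> then c f 0 else Outside))"
    by blast
  obtain n1 where n1: "ends_at 1 (load \<tau>) n1" using ends_at_load[of 1 \<tau>] by auto
  obtain n2 where n2: "ends_at (-1) (load \<tau>) n2" using ends_at_load[of "-1" \<tau>] by auto
  obtain l1 where l1: "ends_at 1 (load \<sigma>) l1" using ends_at_load[of 1 \<sigma>] by auto
  obtain l2 where l2: "ends_at (-1) (load \<sigma>) l2" using ends_at_load[of "-1" \<sigma>] by auto
  let ?P = "\<lambda>s n. \<forall>t\<le>n. c j (s * int t) = c k (s * int t)"
  have eq: "\<sigma> = \<tau> \<longleftrightarrow> ?P 1 n1 \<and> ?P (-1) n2"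
  proof
    assume "?P 1 n1 \<and> ?P (-1) n2"
    then have "load \<sigma> = load \<tau>"
      unfolding \<tau> by (intro tape_eqI ends_at_eq[OF n1 l1] ends_at_eq[OF n2 l2]) blast+
    then show "\<sigma> = \<tau>" using inj_load by (auto dest: injD)
  qed (use \<tau> in auto)
  let ?d = "c(f := (c f)(0 := if ?P 1 n1 then c f 0 else Outside))"
  have d: "?d j = c j" "?d k = c k" "?d m = c m" using assms by auto
  have "c' = ?d(f := (?d f)(0 := if \<forall>t\<le>n2. ?d j (-1 * int t) = ?d k (-1 * int t) then ?d f 0 else Outside))"
    unfolding d c' eq by auto
  then show "((\<lambda>c c'. \<exists>n. ends_at 1 (c k) n \<and> c m = load fmempty \<and>
      c' = c(f := (c f)(0 := if \<forall>t\<le>n. c j (1 * int t) = c k (1 * int t) then c f 0 else Outside)))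
    OO (\<lambda>c c'. \<exists>n. ends_at (-1) (c k) n \<and> c m = load fmempty \<and>
      c' = c(f := (c f)(0 := if \<forall>t\<le>n. c j (-1 * int t) = c k (-1 * int t) then c f 0 else Outside)))) c c'"
    using n1 n2 \<tau> d by (intro relcomppI[of _ _ ?d] exI[of _ n1] exI[of _ n2] conjI) simp_all
qed (use assms in auto)

section \<open>Searching an orbit\<close>

lemma computable_on_iff:
  "computable_on R Q f \<longleftrightarrow> realizable R (\<lambda>c c'. \<exists>\<tau>\<in>Q. c = io_tapes \<tau> \<and> c' = io_tapes (f \<tau>))"
proof -
  have "halts_with R M \<tau> \<sigma> \<longleftrightarrow> runs R M (io_tapes \<tau>) (io_tapes \<sigma>)" for M \<tau> \<sigma>
    unfolding halts_with_def runs_def reaches_def by blast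
  moreover have "(\<forall>\<tau>\<in>Q. runs R M (io_tapes \<tau>) (io_tapes (f \<tau>))) \<longleftrightarrow>
    (\<forall>c c'. (\<exists>\<tau>\<in>Q. c = io_tapes \<tau> \<and> c' = io_tapes (f \<tau>)) \<longrightarrow> runs R M c c')" for M
    by blast
  ultimately show ?thesis unfolding computable_on_def realizable_def by simp
qed

lemma computable_on_cong:
  assumes "computable_on R Q f" "\<And>\<tau>. \<tau> \<in> Q \<Longrightarrow> f \<tau> = g \<tau>"
  shows "computable_on R Q g"
  using assms unfolding computable_on_def by metis

lemma computable_on_comp:
  assumes "computable_on R Q f" "computable_on R Q' g" "f ` Q \<subseteq> Q'"
  shows "computable_on R Q (g \<circ> f)"
  using realizable_seq[OF assms(1,2)[unfolded computable_on_iff]] unfolding computable_on_iff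
  by (rule realizable_mono) (use assms(3) in auto)

text \<open>The machine for \<open>f\<close> gets tape \<open>j\<close> as its tape 0 and tapes
  beyond \<open>N\<close> as its auxiliary tapes. It finds these blank and leaves them blank, so the
  only net effect is on tape \<open>j\<close>.\<close>

lemma realizable_call:
  assumes "computable_on R Q f" "j < N"
  shows "realizable R (\<lambda>c c'. \<exists>\<tau>\<in>Q. c j = load \<tau> \<and> (\<forall>k\<ge>N. c k = load fmempty) \<and>
    c' = c(j := load (f \<tau>)))"
proof -
  define \<rho> where "\<rho> k = (if k = 0 then j else N + k)" for k
  have "inj \<rho>" using assms(2) by (auto simp: inj_def \<rho>_def split: if_splits)
  from realizable_rename[OF assms(1)[unfolded computable_on_iff] this] show ?thesis
  proof (rule realizable_mono)
    fix c c'
    assume "\<exists>\<tau>\<in>Q. c j = load \<tau> \<and> (\<forall>k\<ge>N. c k = load fmempty) \<and> c' = c(j := load (f \<tau>))"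
    then obtain \<tau> where \<tau>: "\<tau> \<in> Q" "c j = load \<tau>" "\<forall>k\<ge>N. c k = load fmempty" "c' = c(j := load (f \<tau>))"
      by blast
    have "c \<circ> \<rho> = io_tapes \<tau>" "c' \<circ> \<rho> = io_tapes (f \<tau>)"
      using \<tau> assms(2) by (auto simp: fun_eq_iff \<rho>_def io_tapes_def)
    moreover have "\<rho> 0 = j" by (simp add: \<rho>_def)
    then have "\<forall>k. k \<notin> range \<rho> \<longrightarrow> c' k = c k" using \<tau>(4) by auto
    ultimately show "(\<exists>\<tau>\<in>Q. c \<circ> \<rho> = io_tapes \<tau> \<and> c' \<circ> \<rho> = io_tapes (f \<tau>)) \<and>
        (\<forall>k. k \<notin> range \<rho> \<longrightarrow> c' k = c k)"
      using \<tau>(1) by blast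
  qed
qed

lemma realizable_init: "realizable R (\<lambda>c c'. c k = load fmempty \<and> c' = c(k := load \<tau>))"
proof (rule realizable_put_finite)
  have "{z. load fmempty z \<noteq> load \<tau> z} \<subseteq> {i. load fmempty i \<noteq> (Outside :: 'a cell)} \<union> {i. load \<tau> i \<noteq> Outside}"
    by auto
  then show "finite {z. load fmempty z \<noteq> load \<tau> z}"
    by (rule finite_subset) (simp add: finite_load)
qed

text \<open>Tape 0 holds the input, tapes 1 and 2 the current points of the two orbits; tape 3 is a flag,
  with \<open>Outside\<close> under its head until the input is reached.\<close>

definition search_tapes :: "'s tape \<Rightarrow> 's tape \<Rightarrow> 's tape \<Rightarrow> nat \<Rightarrow> int \<Rightarrow> 's cell" where
  "search_tapes \<tau> u v = (io_tapes \<tau>)(1 := load u, 2 := load v,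
     3 := (load fmempty)(0 := if u = \<tau> then Cell None else Outside))"

lemma io_tapes_simps: "io_tapes \<tau> 0 = load \<tau>" "k \<noteq> 0 \<Longrightarrow> io_tapes \<tau> k = load fmempty"
  by (simp_all add: io_tapes_def)

lemma load_fmempty_upd: "(load fmempty)(0 := Cell None) = load fmempty"
  by (simp add: fun_eq_iff load_fmempty)

text \<open>The starting points \<open>u\<close> and \<open>v\<close> are constants built into the
  machine, and tape 4 is the blank marker for sweeps. The flag needs no preparation: the blank tape
  3 shows \<open>Cell None\<close>, which the comparison keeps or turns to
  \<open>Outside\<close>.\<close>

lemma realizable_search_start:
  fixes R :: "'s::finite tape set"
  shows "realizable R (\<lambda>c c'. \<exists>\<tau>. c = io_tapes \<tau> \<and> c' = search_tapes \<tau> u v)"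
proof (rule realizable_mono[OF realizable_seq[OF realizable_init[of R 1 u]
        realizable_seq[OF realizable_init[of R 2 v] realizable_compare[of 1 0 4 3 R]]]])
  fix c c' :: "nat \<Rightarrow> int \<Rightarrow> 's cell"
  assume "\<exists>\<tau>. c = io_tapes \<tau> \<and> c' = search_tapes \<tau> u v"
  then obtain \<tau> where c: "c = io_tapes \<tau>" "c' = search_tapes \<tau> u v" by blast
  show "((\<lambda>c c'. c 1 = load fmempty \<and> c' = c(1 := load u)) OO
      (\<lambda>c c'. c 2 = load fmempty \<and> c' = c(2 := load v)) OO
      (\<lambda>c c'. \<exists>\<sigma> \<tau>. c 1 = load \<sigma> \<and> c 0 = load \<tau> \<and> c 4 = load fmempty \<and>
        c' = c(3 := (c 3)(0 := if \<sigma> = \<tau> then c 3 0 else Outside)))) c c'"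
    unfolding c search_tapes_def
    by (intro relcomppI[of _ _ "(io_tapes \<tau>)(1 := load u)"]
        relcomppI[of _ _ "(io_tapes \<tau>)(1 := load u, 2 := load v)"] conjI exI[of _ u] exI[of _ \<tau>])
      (simp_all add: io_tapes_simps load_fmempty)
qed simp

lemma realizable_search_step:
  fixes R :: "'s::finite tape set"
  assumes "computable_on R Q h" "computable_on R Q' h'"
  shows "realizable R (\<lambda>c c'. \<exists>\<tau>. \<exists>u\<in>Q. \<exists>v\<in>Q'. c = search_tapes \<tau> u v \<and>
    c' = search_tapes \<tau> (h u) (h' v))"
\<comment> \<open>The flag is raised first because a comparison can only lower it. The bound 5 keeps
  the scratch tapes of both calls away from tapes 0 to 4.\<close>
proof (rule realizable_mono[OF realizable_seq[OF realizable_put[of R 3 0 "Cell None"]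
        realizable_seq[OF realizable_call[OF assms(1), of 1 5]
        realizable_seq[OF realizable_call[OF assms(2), of 2 5] realizable_compare[of 1 0 4 3 R]]]]])
  fix c c' :: "nat \<Rightarrow> int \<Rightarrow> 's cell"
  assume "\<exists>\<tau>. \<exists>u\<in>Q. \<exists>v\<in>Q'. c = search_tapes \<tau> u v \<and> c' = search_tapes \<tau> (h u) (h' v)"
  then obtain \<tau> u v where uv: "u \<in> Q" "v \<in> Q'"
    and c: "c = search_tapes \<tau> u v" "c' = search_tapes \<tau> (h u) (h' v)"
    by blast
  define D where "D u v = (io_tapes \<tau>)(1 := load u, 2 := load v)" for u v
  have D: "D u v 0 = load \<tau>" "D u v 1 = load u" "D u v 2 = load v" "k \<ge> 3 \<Longrightarrow> D u v k = load fmempty"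
    for u v k
    by (simp_all add: D_def io_tapes_simps)
  have "D u v = c(3 := (c 3)(0 := Cell None))"
    by (simp add: D_def c search_tapes_def load_fmempty_upd fun_eq_iff io_tapes_simps)
  moreover have "D (h u) v = (D u v)(1 := load (h u))" "D (h u) (h' v) = (D (h u) v)(2 := load (h' v))"
    by (simp_all add: D_def fun_eq_iff)
  moreover have "c' = (D (h u) (h' v))(3 := (D (h u) (h' v) 3)
      (0 := if h u = \<tau> then D (h u) (h' v) 3 0 else Outside))"
    by (simp add: c D_def search_tapes_def io_tapes_simps load_fmempty)
  moreover have "\<forall>k\<ge>5. D u v k = load fmempty" "D u v 4 = load fmempty" for u v
    using D(4) by simp_all
  ultimately show "((\<lambda>c c'. c' = c(3 := (c 3)(0 := Cell None))) OO
      (\<lambda>c c'. \<exists>\<tau>\<in>Q. c 1 = load \<tau> \<and> (\<forall>k\<ge>5. c k = load fmempty) \<and> c' = c(1 := load (h \<tau>))) OO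
      (\<lambda>c c'. \<exists>\<tau>\<in>Q'. c 2 = load \<tau> \<and> (\<forall>k\<ge>5. c k = load fmempty) \<and> c' = c(2 := load (h' \<tau>))) OO
      (\<lambda>c c'. \<exists>\<sigma> \<tau>. c 1 = load \<sigma> \<and> c 0 = load \<tau> \<and> c 4 = load fmempty \<and>
        c' = c(3 := (c 3)(0 := if \<sigma> = \<tau> then c 3 0 else Outside)))) c c'"
    by (intro relcomppI[of _ _ "D u v"] relcomppI[of _ _ "D (h u) v"]
        relcomppI[of _ _ "D (h u) (h' v)"] conjI bexI[OF _ uv(1)] bexI[OF _ uv(2)]
        exI[of _ "h u"] exI[of _ \<tau>] D(1,2,3))
qed simp_all

lemma realizable_search_end:
  fixes R :: "'s::finite tape set"
  shows "realizable R (\<lambda>c c'. \<exists>\<tau> v. c = search_tapes \<tau> \<tau> v \<and> c' = io_tapes v)"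
proof (rule realizable_mono[OF realizable_seq[OF realizable_erase[of 4 0 R]
        realizable_seq[OF realizable_erase[of 4 1 R]
        realizable_seq[OF realizable_copy[of 0 2 4 R] realizable_erase[of 4 2 R]]]]])
  fix c c' :: "nat \<Rightarrow> int \<Rightarrow> 's cell"
  assume "\<exists>\<tau> v. c = search_tapes \<tau> \<tau> v \<and> c' = io_tapes v"
  then obtain \<tau> v where c: "c = search_tapes \<tau> \<tau> v" "c' = io_tapes v" by blast
  let ?d1 = "c(0 := load fmempty)"
  let ?d2 = "?d1(1 := load fmempty)"
  let ?d3 = "?d2(0 := load v)"
  have c4: "c 0 = load \<tau>" "c 1 = load \<tau>" "c 2 = load v" "c 4 = load fmempty"
    by (simp_all add: c search_tapes_def io_tapes_simps)
  \<comment> \<open>Once the input is reached, the flag shows \<open>Cell None\<close>; tape 3 is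
    then blank and needs no cleaning.\<close>
  have "c' = ?d3(2 := load fmempty)"
    by (simp add: c search_tapes_def io_tapes_def fun_eq_iff load_fmempty_upd)
  then show "((\<lambda>c c'. \<exists>\<tau>. c 0 = load \<tau> \<and> c 4 = load fmempty \<and> c' = c(0 := load fmempty)) OO
      (\<lambda>c c'. \<exists>\<tau>. c 1 = load \<tau> \<and> c 4 = load fmempty \<and> c' = c(1 := load fmempty)) OO
      (\<lambda>c c'. \<exists>\<tau>. c 2 = load \<tau> \<and> c 0 = load fmempty \<and> c 4 = load fmempty \<and> c' = c(0 := c 2)) OO
      (\<lambda>c c'. \<exists>\<tau>. c 2 = load \<tau> \<and> c 4 = load fmempty \<and> c' = c(2 := load fmempty))) c c'"
    using c4
    by (intro relcomppI[of _ _ ?d1] relcomppI[of _ _ ?d2] relcomppI[of _ _ ?d3]) auto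
qed simp_all

text \<open>The condition on \<open>f\<close> includes well-definedness: if the first orbit revisits
  a point, the second orbit has the same value at both indices. Stopping at the first hit is
  therefore correct.\<close>

lemma computable_on_orbit:
  fixes R :: "'s::finite tape set"
  assumes h: "computable_on R Q h" "h \<in> Q \<rightarrow> Q" "a \<in> Q"
    and h': "computable_on R Q' h'" "h' \<in> Q' \<rightarrow> Q'" "b \<in> Q'"
    and orbit: "\<And>\<tau>. \<tau> \<in> Q \<Longrightarrow> \<exists>i. \<tau> = (h ^^ i) a"
    and f: "\<And>i. f ((h ^^ i) a) = (h' ^^ i) b"
  shows "computable_on R Q f"
proof -
  let ?step = "\<lambda>c c'. \<exists>\<tau>. \<exists>u\<in>Q. \<exists>v\<in>Q'. c = search_tapes \<tau> u v \<and> c' = search_tapes \<tau> (h u) (h' v)"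
  let ?loop = "\<lambda>c c'. (\<lambda>c c'. c 3 0 \<in> {Outside} \<and> ?step c c')\<^sup>*\<^sup>* c c' \<and> c' 3 0 \<notin> {Outside}"
  have in_Q: "(h ^^ i) a \<in> Q" "(h' ^^ i) b \<in> Q'" for i
    using h(2,3) h'(2,3) by (induction i) auto
  have flag: "search_tapes \<tau> u v 3 0 = (if u = \<tau> then Cell None else Outside)" for \<tau> u v :: "'s tape"
    by (simp add: search_tapes_def)
  have "realizable R ((\<lambda>c c'. \<exists>\<tau>. c = io_tapes \<tau> \<and> c' = search_tapes \<tau> a b) OO ?loop OO
      (\<lambda>c c'. \<exists>\<tau> v. c = search_tapes \<tau> \<tau> v \<and> c' = io_tapes v))"
    by (intro realizable_seq realizable_search_start realizable_while realizable_search_step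
        realizable_search_end h(1) h'(1))
  then show ?thesis
    unfolding computable_on_iff
  proof (rule realizable_mono)
    fix c c'
    assume "\<exists>\<tau>\<in>Q. c = io_tapes \<tau> \<and> c' = io_tapes (f \<tau>)"
    then obtain \<tau> where \<tau>: "\<tau> \<in> Q" "c = io_tapes \<tau>" "c' = io_tapes (f \<tau>)" by blast
    \<comment> \<open>Minimality keeps the flag at \<open>Outside\<close> in all earlier rounds, so
      the loop runs exactly \<open>n\<close> times.\<close>
    define n where "n = (LEAST i. \<tau> = (h ^^ i) a)"
    have n: "\<tau> = (h ^^ n) a" using orbit[OF \<tau>(1)] unfolding n_def by (rule LeastI_ex)
    have less: "\<tau> \<noteq> (h ^^ i) a" if "i < n" for i
      using that unfolding n_def by (rule not_less_Least)
    let ?s = "\<lambda>i. search_tapes \<tau> ((h ^^ i) a) ((h' ^^ i) b)"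
    have "(\<lambda>c c'. c 3 0 \<in> {Outside} \<and> ?step c c')\<^sup>*\<^sup>* (?s 0) (?s i)" if "i \<le> n" for i
      using that
    proof (induction i)
      case 0
      show ?case by (rule rtranclp.rtrancl_refl)
    next
      case (Suc i)
      have "?s i 3 0 \<in> {Outside}" using less[of i] Suc.prems by (simp add: flag)
      moreover have "?step (?s i) (?s (Suc i))" using in_Q[of i] by auto
      ultimately show ?case using Suc by (auto intro: rtranclp.rtrancl_into_rtrancl)
    qed
    from this[of n] have "?loop (?s 0) (?s n)" using n by (simp add: flag)
    moreover have "?s 0 = search_tapes \<tau> a b" by simp
    moreover have "?s n = search_tapes \<tau> \<tau> (f \<tau>)"
      using f[of n] n by simp
    ultimately show "((\<lambda>c c'. \<exists>\<tau>. c = io_tapes \<tau> \<and> c' = search_tapes \<tau> a b) OO ?loop OO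
        (\<lambda>c c'. \<exists>\<tau> v. c = search_tapes \<tau> \<tau> v \<and> c' = io_tapes v)) c c'"
      using \<tau>(2,3) by (intro relcomppI[of _ _ "?s 0"] relcomppI[of _ _ "?s n"]) auto
  qed
qed

theorem theorem13:
  fixes R :: "'s::finite tape set" and A :: "'a set" and x y :: "'a \<Rightarrow> 's tape"
  assumes "countable A"
    and "representation A x" and "representation A y"
    and "comp_funs R A x \<subseteq> comp_funs R A y"
    and "ce R (x ` A)"
  shows "ce R (y ` A) \<and> transformationally_equivalent R A x y \<and>
    comp_funs R A x = comp_funs R A y"
proof -
  let ?xi = "the_inv_into A x" and ?yi = "the_inv_into A y"
  have inj: "inj_on x A" "inj_on y A" using assms(2,3) by (simp_all add: representation_def)
  note inv = the_inv_into_f_f[OF inj(1)] the_inv_into_f_f[OF inj(2)]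
  obtain h \<tau>\<^sub>0 where h: "h \<in> x ` A \<rightarrow> x ` A" "computable_on R (x ` A) h" and \<tau>\<^sub>0: "\<tau>\<^sub>0 \<in> x ` A"
    and gen: "\<forall>\<tau>\<in>x ` A. \<exists>i. \<tau> = (h ^^ i) \<tau>\<^sub>0"
    using assms(5) unfolding ce_def by (elim exE conjE)
  obtain a where a: "a \<in> A" "\<tau>\<^sub>0 = x a" using \<tau>\<^sub>0 by (rule imageE)
  have orbit: "\<exists>i. \<tau> = (h ^^ i) (x a)" if "\<tau> \<in> x ` A" for \<tau>
    using gen[rule_format, OF that] unfolding a(2) .
  note a = a(1)
  \<comment> \<open>\<open>g\<close> is \<open>h\<close> pulled back along \<open>x\<close>,
    restricted because members of \<open>comp_funs\<close> are extensional.\<close>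
  define g where "g = restrict (\<lambda>b. ?xi (h (x b))) A"
  have xg: "g b \<in> A" "x (g b) = h (x b)" if "b \<in> A" for b
  proof -
    have "h (x b) \<in> x ` A" using h(1) that by (rule funcset_mem[OF _ imageI])
    then obtain b' where "b' \<in> A" "h (x b) = x b'" by (rule imageE)
    then show "g b \<in> A" "x (g b) = h (x b)" using that by (simp_all add: g_def inv)
  qed
  have "computable_on R (x ` A) (x \<circ> g \<circ> ?xi)"
    by (rule computable_on_cong[OF h(2)]) (auto simp: inv xg)
  moreover have "g \<in> A \<rightarrow>\<^sub>E A" using xg(1) by (auto intro: PiE_I simp: g_def)
  ultimately have "g \<in> comp_funs R A x" by (simp add: comp_funs_def)
  then have "g \<in> comp_funs R A y" using assms(4) by (rule subsetD[rotated])
  define h' where "h' = y \<circ> g \<circ> ?yi"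
  have h': "computable_on R (y ` A) h'"
    using \<open>g \<in> comp_funs R A y\<close> by (simp add: comp_funs_def h'_def)
  have h'_maps: "h' \<in> y ` A \<rightarrow> y ` A" by (auto simp: h'_def inv xg)
  \<comment> \<open>The same index \<open>i\<close> drives all three iterations; this yields the
    condition on \<open>f\<close> in \<open>computable_on_orbit\<close> for both
    translations.\<close>
  have iter: "(g ^^ i) a \<in> A" "(h ^^ i) (x a) = x ((g ^^ i) a)" "(h' ^^ i) (y a) = y ((g ^^ i) a)" for i
    by (induction i) (simp_all add: a h'_def inv xg)
  have onto: "\<exists>i. b = (g ^^ i) a" if b: "b \<in> A" for b
  proof -
    obtain i where "x b = (h ^^ i) (x a)" using orbit[OF imageI[OF b]] by (elim exE)
    then have "x b = x ((g ^^ i) a)" by (simp add: iter)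
    \<comment> \<open>Injectivity of \<open>x\<close> brings the enumeration back to
      \<open>A\<close>, from where \<open>y\<close> carries it to the other side.\<close>
    then have "b = (g ^^ i) a" by (rule inj_onD[OF inj(1) _ b iter(1)])
    then show ?thesis ..
  qed
  have orbit': "\<exists>i. \<tau> = (h' ^^ i) (y a)" if "\<tau> \<in> y ` A" for \<tau>
    using that
  proof
    fix b assume b: "\<tau> = y b" "b \<in> A"
    obtain i where "b = (g ^^ i) a" using onto[OF b(2)] by (elim exE)
    then have "\<tau> = (h' ^^ i) (y a)" unfolding b(1) iter(3) by simp
    then show ?thesis ..
  qed
  have "ce R (y ` A)"
    unfolding ce_def
    by (intro exI[of _ h'] exI[of _ "y a"] conjI ballI h' h'_maps imageI a orbit')
  moreover have xy: "computable_on R (x ` A) (y \<circ> ?xi)"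
    by (rule computable_on_orbit[OF h(2,1) imageI[OF a] h' h'_maps imageI[OF a] orbit])
      (simp_all add: iter inv)
  \<comment> \<open>The same search with the roles exchanged, available because \<open>h'\<close> is
    now known to enumerate the image of \<open>A\<close> under \<open>y\<close>.\<close>
  moreover have yx: "computable_on R (y ` A) (x \<circ> ?yi)"
    by (rule computable_on_orbit[OF h' h'_maps imageI[OF a] h(2,1) imageI[OF a] orbit'])
      (simp_all add: iter inv)
  moreover have "comp_funs R A y \<subseteq> comp_funs R A x"
  proof
    fix f assume "f \<in> comp_funs R A y"
    then have f: "f \<in> A \<rightarrow>\<^sub>E A" "computable_on R (y ` A) (y \<circ> f \<circ> ?yi)"
      by (auto simp: comp_funs_def)
    have fA: "f b \<in> A" if "b \<in> A" for b using f(1) that by blast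
    have "computable_on R (x ` A) ((x \<circ> ?yi) \<circ> ((y \<circ> f \<circ> ?yi) \<circ> (y \<circ> ?xi)))"
      by (rule computable_on_comp[OF computable_on_comp[OF xy f(2)] yx]) (auto simp: inv fA)
    then have "computable_on R (x ` A) (x \<circ> f \<circ> ?xi)"
      by (rule computable_on_cong) (auto simp: inv fA)
    then show "f \<in> comp_funs R A x" using f(1) by (simp add: comp_funs_def)
  qed
  ultimately show ?thesis
    using assms(4) by (simp add: transformationally_equivalent_def)
qed

end
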